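(* For every $n\geq 4$, the free 2-step nilpotent real Lie algebra in $n$ generators admits a non-trivial closed 2-form of type II but does not admit any symplectic structure.
   Context: The free 2-step nilpotent real Lie algebra in $n$ generators is the Lie algebra with basis $\{V_i\}_{1\le i\le n}\cup\{Z_{ij}\}_{1\le i<j\le n}$ and non-trivial brackets $[V_i,V_j]=Z_{ij}=-[V_j,V_i]$ for $i<j$. A 2-form $\omega$ on a Lie algebra $\mathfrak{n}$ is closed if $\omega([U,V],W)+\omega([V,W],U)+\omega([W,U],V)=0$ for all $U,V,W\in\mathfrak{n}$; a symplectic structure is a closed non-degenerate 2-form. With $\mathfrak{z}$ the center of $\mathfrak{n}$, a 2-form $\omega$ is of type II if $\omega(Z,Z')=0$ for all $Z,Z'\in\mathfrak{z}$, but $\omega(Z,U)\neq0$ for some $Z\in\mathfrak{z}$, $U\in\mathfrak{n}$. *)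

theory Defs
  imports "HOL-Analysis.Analysis"
begin

locale lie_algebra =
  fixes bracket :: "'a::real_vector \<Rightarrow> 'a \<Rightarrow> 'a"
  assumes bilinear_bracket: "bilinear bracket"
    and bracket_self: "bracket x x = 0"
    and jacobi: "bracket x (bracket y z) + bracket y (bracket z x) + bracket z (bracket x y) = 0"

definition center :: "('a::real_vector \<Rightarrow> 'a \<Rightarrow> 'a) \<Rightarrow> 'a set" where
  "center bracket = {z. \<forall>u. bracket z u = 0}"

definition two_form :: "('a::real_vector \<Rightarrow> 'a \<Rightarrow> real) \<Rightarrow> bool" where
  "two_form \<omega> \<longleftrightarrow> bilinear \<omega> \<and> (\<forall>u. \<omega> u u = 0)"

definition closed_two_form ::
  "('a::real_vector \<Rightarrow> 'a \<Rightarrow> 'a) \<Rightarrow> ('a \<Rightarrow> 'a \<Rightarrow> real) \<Rightarrow> bool" where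
  "closed_two_form bracket \<omega> \<longleftrightarrow> two_form \<omega> \<and>
     (\<forall>u v w. \<omega> (bracket u v) w + \<omega> (bracket v w) u + \<omega> (bracket w u) v = 0)"

definition nondegenerate :: "('a::real_vector \<Rightarrow> 'a \<Rightarrow> real) \<Rightarrow> bool" where
  "nondegenerate \<omega> \<longleftrightarrow> (\<forall>u. (\<forall>v. \<omega> u v = 0) \<longrightarrow> u = 0)"

definition symplectic ::
  "('a::real_vector \<Rightarrow> 'a \<Rightarrow> 'a) \<Rightarrow> ('a \<Rightarrow> 'a \<Rightarrow> real) \<Rightarrow> bool" where
  "symplectic bracket \<omega> \<longleftrightarrow> closed_two_form bracket \<omega> \<and> nondegenerate \<omega>"

definition type_II ::
  "('a::real_vector \<Rightarrow> 'a \<Rightarrow> 'a) \<Rightarrow> ('a \<Rightarrow> 'a \<Rightarrow> real) \<Rightarrow> bool" where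
  "type_II bracket \<omega> \<longleftrightarrow> two_form \<omega> \<and>
     (\<forall>z\<in>center bracket. \<forall>z'\<in>center bracket. \<omega> z z' = 0) \<and>
     (\<exists>z\<in>center bracket. \<exists>u. \<omega> z u \<noteq> 0)"

definition free_index :: "nat \<Rightarrow> (nat + nat \<times> nat) set" where
  "free_index n = {1..n} <+> {(i, j). 1 \<le> i \<and> i < j \<and> j \<le> n}"

definition free_family ::
  "(nat \<Rightarrow> 'a) \<Rightarrow> (nat \<Rightarrow> nat \<Rightarrow> 'a) \<Rightarrow> nat + nat \<times> nat \<Rightarrow> 'a" where
  "free_family V Z = case_sum V (\<lambda>(i, j). Z i j)"

text \<open>The Lie algebra is the whole type. The brackets of basis vectors that are not listed
  below are determined by antisymmetry.\<close>

locale free_two_step_nilpotent = lie_algebra bracket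
  for bracket :: "'a::real_vector \<Rightarrow> 'a \<Rightarrow> 'a" +
  fixes n :: nat and V :: "nat \<Rightarrow> 'a" and Z :: "nat \<Rightarrow> nat \<Rightarrow> 'a"
  assumes inj_basis: "inj_on (free_family V Z) (free_index n)"
    and independent_basis: "independent (free_family V Z ` free_index n)"
    and span_basis: "span (free_family V Z ` free_index n) = UNIV"
    and bracket_V_V: "\<lbrakk>1 \<le> i; i < j; j \<le> n\<rbrakk> \<Longrightarrow> bracket (V i) (V j) = Z i j"
    and bracket_V_Z: "\<lbrakk>1 \<le> i; i \<le> n; 1 \<le> j; j < k; k \<le> n\<rbrakk> \<Longrightarrow> bracket (V i) (Z j k) = 0"
    and bracket_Z_Z: "\<lbrakk>1 \<le> i; i < j; j \<le> n; 1 \<le> k; k < l; l \<le> n\<rbrakk>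
                      \<Longrightarrow> bracket (Z i j) (Z k l) = 0"

text \<open>Such a Lie algebra exists for every positive n, on any Euclidean space of the right dimension,
  so the locale assumptions are never contradictory.\<close>

lemma free_two_step_nilpotent_exists:
  fixes n :: nat
  assumes dim: "DIM('a::euclidean_space) = card (free_index n)"
  shows "\<exists>(bracket :: 'a \<Rightarrow> 'a \<Rightarrow> 'a) V Z. free_two_step_nilpotent bracket n V Z"
proof -
  let ?P = "{(i, j). 1 \<le> i \<and> i < j \<and> j \<le> n}"
  have finP: "finite ?P"
    by (rule finite_subset[of _ "{1..n} \<times> {1..n}"]) auto
  have "finite (free_index n)"
    unfolding free_index_def using finP by (intro finite_Plus) auto
  then obtain b where b: "bij_betw b (free_index n) (Basis :: 'a set)"
    using finite_same_card_bij[of "free_index n" "Basis :: 'a set"] dim by auto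
  define V where "V i = b (Inl i)" for i
  define Z where "Z i j = b (Inr (i, j))" for i j
  define br where "br x y = (\<Sum>(i, j)\<in>?P. ((x \<bullet> V i) * (y \<bullet> V j) - (x \<bullet> V j) * (y \<bullet> V i)) *\<^sub>R Z i j)"
    for x y
  have fam: "free_family V Z = b"
    by (auto simp: fun_eq_iff free_family_def V_def Z_def split: sum.splits)
  have inj: "inj_on b (free_index n)" and img: "b ` free_index n = Basis"
    using b by (auto simp: bij_betw_def)
  have inn: "b p \<bullet> b q = (if p = q then 1 else 0)" if "p \<in> free_index n" "q \<in> free_index n" for p q
  proof -
    have "b p \<in> Basis" "b q \<in> Basis"
      using that img by auto
    then show ?thesis
      using that inj by (simp add: inner_Basis inj_on_eq_iff)
  qed
  have idx: "Inl i \<in> free_index n \<longleftrightarrow> 1 \<le> i \<and> i \<le> n"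
    "Inr (i, j) \<in> free_index n \<longleftrightarrow> 1 \<le> i \<and> i < j \<and> j \<le> n" for i j
    by (auto simp: free_index_def)
  have VV: "V i \<bullet> V j = (if i = j then 1 else 0)" if "1 \<le> i" "i \<le> n" "1 \<le> j" "j \<le> n" for i j
    using that by (simp add: V_def inn idx)
  have ZV: "Z i j \<bullet> V k = 0" if "1 \<le> i" "i < j" "j \<le> n" "1 \<le> k" "k \<le> n" for i j k
    using that by (simp add: V_def Z_def inn idx)
  have br0: "br x (Z i j) = 0" if "1 \<le> i" "i < j" "j \<le> n" for x i j
    unfolding br_def using that by (intro sum.neutral) (auto simp: ZV)
  have linr: "linear (br x)" for x
    unfolding br_def
    by (rule linearI)
       (simp_all add: case_prod_unfold scaleR_sum_right sum.distrib[symmetric] algebra_simps)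
  have anti: "br x y = - br y x" for x y
    unfolding br_def sum_negf[symmetric]
    by (intro sum.cong) (auto simp: algebra_simps)
  have linl: "linear (\<lambda>x. br x y)" for y
  proof -
    have "(\<lambda>x. br x y) = (\<lambda>x. - br y x)"
      by (rule ext) (rule anti)
    then show ?thesis
      using linear_compose_neg[OF linr[of y]] by (simp only:)
  qed
  have nil: "br x (br y z) = 0" for x y z
  proof -
    have "br x (br y z) = (\<Sum>p\<in>?P. case p of (i, j) \<Rightarrow>
            ((y \<bullet> V i) * (z \<bullet> V j) - (y \<bullet> V j) * (z \<bullet> V i)) *\<^sub>R br x (Z i j))"
      unfolding br_def[of y z] linear_sum[OF linr]
      by (intro sum.cong) (auto simp: linear_cmul[OF linr])
    also have "\<dots> = 0"
      by (intro sum.neutral) (auto simp: br0)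
    finally show ?thesis .
  qed
  have brV: "br (V i) (V j) = Z i j" if "1 \<le> i" "i < j" "j \<le> n" for i j
  proof -
    have "br (V i) (V j) = (\<Sum>p\<in>?P. if p = (i, j) then Z i j else 0)"
      unfolding br_def using that by (intro sum.cong) (auto simp: VV split: if_splits)
    then show ?thesis
      using that finP by (simp add: sum.delta)
  qed
  have "free_two_step_nilpotent br n V Z"
  proof
    show "bilinear br"
      using linl linr by (simp add: bilinear_def)
    show "br x x = 0" for x
      by (simp add: br_def mult.commute)
    show "br x (br y z) + br y (br z x) + br z (br x y) = 0" for x y z
      by (simp add: nil)
    show "inj_on (free_family V Z) (free_index n)"
      by (simp only: fam inj)
    show "independent (free_family V Z ` free_index n)"
      by (simp add: fam img independent_Basis)
    show "span (free_family V Z ` free_index n) = UNIV"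
      by (simp only: fam img span_Basis)
    show "br (V i) (V j) = Z i j" if "1 \<le> i" "i < j" "j \<le> n" for i j
      using that by (rule brV)
    show "br (V i) (Z j k) = 0" if "1 \<le> i" "i \<le> n" "1 \<le> j" "j < k" "k \<le> n" for i j k
      using that(3-5) by (rule br0)
    show "br (Z i j) (Z k l) = 0"
      if "1 \<le> i" "i < j" "j \<le> n" "1 \<le> k" "k < l" "l \<le> n" for i j k l
      using that(4-6) by (rule br0)
  qed
  then show ?thesis by blast
qed

end

theory Submission imports Defs begin

text \<open>Write \<open>v\<^sub>i\<close>, \<open>z\<^sub>i\<^sub>j\<close> for the coordinates dual to the basis \<open>V i\<close>, \<open>Z i j\<close>. The 1-form
  \<open>z\<^sub>1\<^sub>2\<close> satisfies \<open>z\<^sub>1\<^sub>2 [u, v] = (v\<^sub>1 \<and> v\<^sub>2)(u, v)\<close>, while \<open>v\<^sub>1\<close> vanishes on brackets. Hence the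
  differential of \<open>z\<^sub>1\<^sub>2 \<and> v\<^sub>1\<close> is, up to sign, \<open>v\<^sub>1 \<and> v\<^sub>2 \<and> v\<^sub>1 = 0\<close>, and this form pairs the
  central vector \<open>Z 1 2\<close> with \<open>V 1\<close>. It vanishes on pairs of central elements, because \<open>v\<^sub>1\<close> does:
  a central \<open>z\<close> has \<open>0 = z\<^sub>1\<^sub>2 [z, V 2] = v\<^sub>1 z\<close>. (Lemma \<open>type_II_form_exists\<close>.)

  No symplectic form exists because the derived algebra is too big. A closed form pairs a bracket
  with a central element to zero, so the span of the \<open>Z i j\<close>, of dimension \<open>n (n - 1) / 2\<close>, is
  isotropic, and it has the span of the \<open>V i\<close>, of dimension \<open>n\<close>, as a complement. A nondegenerate
  form embeds an isotropic subspace into the dual of any complement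
  (lemma \<open>isotropic_card_le\<close>), so that \<open>n (n - 1) / 2 \<le> n\<close>, which is false for \<open>n \<ge> 4\<close>.\<close>

section \<open>Forms on real vector spaces\<close>

lemma bilinear_wedge:
  fixes f g :: "'a::real_vector \<Rightarrow> real"
  assumes "linear f" "linear g"
  shows "bilinear (\<lambda>u w. f u * g w - f w * g u)"
  unfolding bilinear_def
  by (intro conjI allI linearI)
     (simp_all add: linear_add[OF assms(1)] linear_add[OF assms(2)]
        linear_cmul[OF assms(1)] linear_cmul[OF assms(2)] algebra_simps)

text \<open>The hypotheses say \<open>df = - g \<and> h\<close> and \<open>dg = 0\<close>, so \<open>d (f \<and> g) = - g \<and> h \<and> g = 0\<close>.\<close>

lemma closed_two_form_wedge:
  assumes "linear f" "linear g"
    and df: "\<And>u v. f (bracket u v) = g u * h v - g v * h u"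
    and dg: "\<And>u v. g (bracket u v) = 0"
  shows "closed_two_form bracket (\<lambda>u w. f u * g w - f w * g u)"
  using bilinear_wedge[OF assms(1,2)]
  by (simp add: closed_two_form_def two_form_def df dg algebra_simps)

text \<open>The vectors of \<open>B\<close> pair to zero with each other, so a vector in their span is determined
  by its pairings with \<open>C\<close>.\<close>

lemma isotropic_card_le:
  fixes \<omega> :: "'a::real_vector \<Rightarrow> 'a \<Rightarrow> real"
  assumes form: "two_form \<omega>" and nondeg: "nondegenerate \<omega>"
    and fin: "finite C" and indep: "independent (B \<union> C)" and span: "span (B \<union> C) = UNIV"
    and iso: "\<And>x y. x \<in> B \<Longrightarrow> y \<in> B \<Longrightarrow> \<omega> x y = 0"
  shows "card B \<le> card C"
proof -
  have lin_right: "linear (\<omega> u)" and lin_left: "linear (\<lambda>x. \<omega> x u)" for u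
    using form by (auto simp: two_form_def bilinear_def)
  have indB: "independent B" and indC: "independent C"
    using independent_mono[OF indep] by auto
  \<comment> \<open>The map into the dual of the complement; \<open>C\<close> serves as a basis of that dual.\<close>
  define T where "T x = (\<Sum>c\<in>C. \<omega> x c *\<^sub>R c)" for x
  have linT: "linear T"
    unfolding T_def
    by (rule linearI)
       (simp_all add: linear_add[OF lin_left] linear_cmul[OF lin_left]
          scaleR_add_left sum.distrib scaleR_sum_right)
  have "x = 0" if x: "x \<in> span B" and "T x = 0" for x
  proof -
    have "\<omega> x c = 0" if "c \<in> C" for c
      using independentD[OF indC fin order_refl _ that] \<open>T x = 0\<close> unfolding T_def by blast
    moreover have "\<omega> x b = 0" if "b \<in> B" for b
      using linear_eq_0_on_span[OF lin_left _ x] iso that by blast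
    ultimately have "\<omega> x y = 0" for y
      using linear_eq_0_on_span[OF lin_right, of "B \<union> C" x y] span by blast
    then show "x = 0"
      using nondeg by (simp add: nondegenerate_def)
  qed
  then have inj: "inj_on T (span B)"
    by (simp add: linear_inj_on_iff_eq_0[OF linT])
  have "T x \<in> span C" for x
    unfolding T_def by (intro span_sum span_mul span_base)
  then have "card (T ` B) \<le> card C"
    using independent_span_bound[OF fin linear_independent_injective_image[OF linT indB inj]]
    by blast
  moreover have "card (T ` B) = card B"
    using inj inj_on_subset span_superset by (intro card_image) blast
  ultimately show ?thesis by simp
qed

section \<open>The free 2-step nilpotent Lie algebra\<close>

lemma (in lie_algebra) bracket_linear: "linear (bracket u)" "linear (\<lambda>x. bracket x u)"
  using bilinear_bracket unfolding bilinear_def by blast+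

lemma (in lie_algebra) bracket_anti: "bracket x y = - bracket y x"
proof -
  have "bracket x y + bracket y x = bracket (x + y) (x + y)"
    unfolding linear_add[OF bracket_linear(1)] linear_add[OF bracket_linear(2)]
    by (simp add: bracket_self)
  also have "\<dots> = 0"
    by (rule bracket_self)
  finally show ?thesis
    by (rule eq_neg_iff_add_eq_0[THEN iffD2])
qed

lemma free_index_iff:
  "Inl i \<in> free_index n \<longleftrightarrow> 1 \<le> i \<and> i \<le> n"
  "Inr (i, j) \<in> free_index n \<longleftrightarrow> 1 \<le> i \<and> i < j \<and> j \<le> n"
  by (auto simp: free_index_def)

lemma card_pairs_gt:
  assumes "n \<ge> 4"
  shows "n < card {(i, j). 1 \<le> i \<and> i < j \<and> j \<le> (n::nat)}"
proof -
  have "{(i, j). 1 \<le> i \<and> i < j \<and> j \<le> n} = (\<lambda>(j, i). (i, j)) ` (SIGMA j:{1..n}. {1..<j})"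
    by force
  then have "card {(i, j). 1 \<le> i \<and> i < j \<and> j \<le> n} = card (SIGMA j:{1..n}. {1..<j})"
    by (simp add: card_image inj_on_def split_beta prod_eq_iff)
  also have "\<dots> = (\<Sum>j=1..n. j - 1)"
    by simp
  also have "\<dots> > n"
    using assms
  proof (induction n rule: dec_induct)
    case base
    show ?case by (simp add: numeral_eq_Suc)
  next
    case (step m)
    then show ?case by simp
  qed
  finally show ?thesis .
qed

context free_two_step_nilpotent
begin

lemma basis_cases:
  assumes "x \<in> free_family V Z ` free_index n"
  obtains i where "x = V i" "1 \<le> i" "i \<le> n"
  | i j where "x = Z i j" "1 \<le> i" "i < j" "j \<le> n"
  using assms by (auto simp: free_index_def free_family_def)

lemma coordinate_functional:
  obtains \<phi> :: "'a \<Rightarrow> real" where "linear \<phi>"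
    "\<And>i. 1 \<le> i \<Longrightarrow> i \<le> n \<Longrightarrow> \<phi> (V i) = a i"
    "\<And>i j. 1 \<le> i \<Longrightarrow> i < j \<Longrightarrow> j \<le> n \<Longrightarrow> \<phi> (Z i j) = b i j"
proof -
  let ?c = "case_sum a (\<lambda>(i, j). b i j)"
  obtain \<phi> :: "'a \<Rightarrow> real" where lin: "linear \<phi>"
    and \<phi>: "\<forall>x\<in>free_family V Z ` free_index n.
              \<phi> x = ?c (inv_into (free_index n) (free_family V Z) x)"
    using linear_independent_extend[OF independent_basis,
        of "\<lambda>x. ?c (inv_into (free_index n) (free_family V Z) x)"] by (elim exE conjE)
  have coord: "\<phi> (free_family V Z p) = ?c p" if p: "p \<in> free_index n" for p
    using bspec[OF \<phi> imageI[OF p]] by (simp only: inv_into_f_f[OF inj_basis p])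
  show ?thesis
  proof (rule that[OF lin])
    show "\<phi> (V i) = a i" if "1 \<le> i" "i \<le> n" for i
      using coord[of "Inl i"] that by (simp add: free_index_iff free_family_def)
    show "\<phi> (Z i j) = b i j" if "1 \<le> i" "i < j" "j \<le> n" for i j
      using coord[of "Inr (i, j)"] that by (simp add: free_index_iff free_family_def)
  qed
qed

lemma bracket_Z_right:
  assumes "1 \<le> i" "i < j" "j \<le> n"
  shows "bracket u (Z i j) = 0"
proof (rule linear_eq_0_on_span[OF bracket_linear(2)])
  show "u \<in> span (free_family V Z ` free_index n)"
    by (simp add: span_basis)
  show "bracket x (Z i j) = 0" if "x \<in> free_family V Z ` free_index n" for x
    using that assms by (cases rule: basis_cases) (simp_all add: bracket_V_Z bracket_Z_Z)
qed

lemma bracket_Z_left: "1 \<le> i \<Longrightarrow> i < j \<Longrightarrow> j \<le> n \<Longrightarrow> bracket (Z i j) u = 0"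
  using bracket_anti[of "Z i j" u] by (simp add: bracket_Z_right)

text \<open>A bilinear map is compared with the bracket on basis vectors; antisymmetry leaves
  only the brackets of \<open>V i\<close> with \<open>V j\<close> for \<open>i < j\<close>.\<close>

lemma functional_bracket_eq:
  fixes \<phi> :: "'a \<Rightarrow> real"
  assumes lin: "linear \<phi>" and bil: "bilinear \<beta>" and anti: "\<And>u v. \<beta> u v = - \<beta> v u"
    and VV: "\<And>i j. 1 \<le> i \<Longrightarrow> i < j \<Longrightarrow> j \<le> n \<Longrightarrow> \<beta> (V i) (V j) = \<phi> (Z i j)"
    and Z: "\<And>i j u. 1 \<le> i \<Longrightarrow> i < j \<Longrightarrow> j \<le> n \<Longrightarrow> \<beta> (Z i j) u = 0"
  shows "\<phi> (bracket u v) = \<beta> u v"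
proof (rule bilinear_eq[where f = "\<lambda>u v. \<phi> (bracket u v)"])
  show "bilinear (\<lambda>u v. \<phi> (bracket u v))"
    using linear_compose[OF bracket_linear(1) lin] linear_compose[OF bracket_linear(2) lin]
    by (simp add: bilinear_def o_def)
  show "bilinear \<beta>" by (fact bil)
  show "UNIV \<subseteq> span (free_family V Z ` free_index n)"
    "UNIV \<subseteq> span (free_family V Z ` free_index n)"
    by (simp_all add: span_basis)
  have ZR: "\<beta> u (Z i j) = 0" if "1 \<le> i" "i < j" "j \<le> n" for i j u
    using anti[of u "Z i j"] Z[OF that] by simp
  have self: "\<beta> u u = 0" for u
    using anti[of u u] by simp
  have VV_all: "\<phi> (bracket (V i) (V j)) = \<beta> (V i) (V j)"
    if "1 \<le> i" "i \<le> n" "1 \<le> j" "j \<le> n" for i j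
  proof (cases i j rule: linorder_cases)
    case less
    then show ?thesis using that by (simp add: bracket_V_V VV)
  next
    case equal
    then show ?thesis by (simp add: bracket_self self linear_0[OF lin])
  next
    case greater
    then show ?thesis
      using that bracket_anti[of "V i" "V j"] anti[of "V i" "V j"]
      by (simp add: bracket_V_V VV linear_neg[OF lin])
  qed
  show "\<phi> (bracket x y) = \<beta> x y"
    if "x \<in> free_family V Z ` free_index n" "y \<in> free_family V Z ` free_index n" for x y
    using that(1)
  proof (cases rule: basis_cases)
    case x: (1 i)
    show ?thesis
      using that(2) x(2,3)
      by (cases rule: basis_cases)
         (simp_all add: x(1) VV_all bracket_Z_right ZR linear_0[OF lin])
  qed (simp add: bracket_Z_left Z linear_0[OF lin])
qed auto

lemma type_II_form_exists:
  assumes "n \<ge> 2"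
  obtains \<omega> where "closed_two_form bracket \<omega>" "\<omega> \<noteq> (\<lambda>_ _. 0)" "type_II bracket \<omega>"
proof -
  obtain f where f: "linear f" "\<And>i. 1 \<le> i \<Longrightarrow> i \<le> n \<Longrightarrow> f (V i) = 0"
    "\<And>i j. 1 \<le> i \<Longrightarrow> i < j \<Longrightarrow> j \<le> n \<Longrightarrow> f (Z i j) = (if i = 1 \<and> j = 2 then 1 else 0 :: real)"
    using coordinate_functional[of "\<lambda>_. 0" "\<lambda>i j. if i = 1 \<and> j = 2 then 1 else 0"] by blast
  obtain g where g: "linear g"
    "\<And>i. 1 \<le> i \<Longrightarrow> i \<le> n \<Longrightarrow> g (V i) = (if i = 1 then 1 else 0 :: real)"
    "\<And>i j. 1 \<le> i \<Longrightarrow> i < j \<Longrightarrow> j \<le> n \<Longrightarrow> g (Z i j) = 0"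
    using coordinate_functional[of "\<lambda>i. if i = 1 then 1 else 0" "\<lambda>_ _. 0"] by blast
  obtain h where h: "linear h"
    "\<And>i. 1 \<le> i \<Longrightarrow> i \<le> n \<Longrightarrow> h (V i) = (if i = 2 then 1 else 0 :: real)"
    "\<And>i j. 1 \<le> i \<Longrightarrow> i < j \<Longrightarrow> j \<le> n \<Longrightarrow> h (Z i j) = 0"
    using coordinate_functional[of "\<lambda>i. if i = 2 then 1 else 0" "\<lambda>_ _. 0"] by blast
  let ?\<omega> = "\<lambda>u w. f u * g w - f w * g u"
  have df: "f (bracket u v) = g u * h v - g v * h u" for u v
    using bilinear_wedge[OF g(1) h(1)]
    by (intro functional_bracket_eq[OF f(1)]) (auto simp: f g h)
  have dg: "g (bracket u v) = 0" for u v
    by (intro functional_bracket_eq[OF g(1)]) (auto simp: g bilinear_def linear_zero)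
  have closed: "closed_two_form bracket ?\<omega>"
    by (rule closed_two_form_wedge[OF f(1) g(1) df dg])
  have central_g: "g z = 0" if "z \<in> center bracket" for z
    using df[of z "V 2"] that assms by (simp add: center_def g h linear_0[OF f(1)])
  have pair: "?\<omega> (Z 1 2) (V 1) \<noteq> 0" and "Z 1 2 \<in> center bracket"
    using assms by (auto simp: f g center_def bracket_Z_left)
  then have "type_II bracket ?\<omega>"
    using closed central_g unfolding type_II_def closed_two_form_def
    by (intro conjI ballI) (blast, simp, blast)
  moreover have "?\<omega> \<noteq> (\<lambda>_ _. 0)"
    using pair by metis
  ultimately show ?thesis
    using that closed by blast
qed

text \<open>Closedness applied to \<open>V i\<close>, \<open>V j\<close> and a central element leaves a single term.\<close>

lemma closed_form_isotropic:
  assumes "closed_two_form bracket \<omega>"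
    and ij: "1 \<le> i" "i < j" "j \<le> n" and kl: "1 \<le> k" "k < l" "l \<le> n"
  shows "\<omega> (Z i j) (Z k l) = 0"
proof -
  have "bilinear \<omega>"
    using assms(1) unfolding closed_two_form_def two_form_def by blast
  then have "\<omega> 0 u = 0" for u
    by (rule bilinear_lzero)
  moreover have "\<omega> (bracket (V i) (V j)) (Z k l) + \<omega> (bracket (V j) (Z k l)) (V i)
      + \<omega> (bracket (Z k l) (V i)) (V j) = 0"
    using assms(1) unfolding closed_two_form_def by blast
  ultimately show ?thesis
    by (simp add: bracket_V_V[OF ij] bracket_Z_left[OF kl] bracket_Z_right[OF kl])
qed

lemma not_symplectic:
  assumes "n \<ge> 4"
  shows "\<not> symplectic bracket \<omega>"
proof
  assume "symplectic bracket \<omega>"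
  then have closed: "closed_two_form bracket \<omega>" and nondeg: "nondegenerate \<omega>"
    and form: "two_form \<omega>"
    unfolding symplectic_def closed_two_form_def by blast+
  let ?P = "{(i, j). 1 \<le> i \<and> i < j \<and> j \<le> n}"
  let ?B = "case_prod Z ` ?P" and ?C = "V ` {1..n}"
  have BC: "?B \<union> ?C = free_family V Z ` free_index n"
    by (auto simp: free_index_def free_family_def Plus_def image_Un image_image)
  have "inj_on (case_prod Z) ?P"
  proof (rule inj_onI)
    fix p q
    assume "p \<in> ?P" "q \<in> ?P" "case_prod Z p = case_prod Z q"
    then have "Inr p = (Inr q :: nat + nat \<times> nat)"
      by (intro inj_onD[OF inj_basis]) (auto simp: free_family_def free_index_def)
    then show "p = q" by simp
  qed
  then have "card ?P = card ?B"
    by (simp add: card_image)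
  also have "\<dots> \<le> card ?C"
  proof (rule isotropic_card_le[OF form nondeg])
    show "finite ?C" by simp
    show "independent (?B \<union> ?C)" "span (?B \<union> ?C) = UNIV"
      unfolding BC by (fact independent_basis span_basis)+
    show "\<omega> x y = 0" if "x \<in> ?B" "y \<in> ?B" for x y
      using that by (auto intro: closed_form_isotropic[OF closed])
  qed
  also have "\<dots> \<le> n"
    using card_image_le[of "{1..n}" V] by simp
  finally show False
    using card_pairs_gt[OF assms] by simp
qed

end

theorem mainTheorem7:
  fixes n :: nat
    and bracket :: "'a::real_vector \<Rightarrow> 'a \<Rightarrow> 'a"
    and V :: "nat \<Rightarrow> 'a" and Z :: "nat \<Rightarrow> nat \<Rightarrow> 'a"
  assumes "n \<ge> 4"
    and "free_two_step_nilpotent bracket n V Z"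
  shows "(\<exists>\<omega>. closed_two_form bracket \<omega> \<and> \<omega> \<noteq> (\<lambda>_ _. 0) \<and> type_II bracket \<omega>) \<and>
         \<not> (\<exists>\<omega>. symplectic bracket \<omega>)"
proof -
  interpret free_two_step_nilpotent bracket n V Z
    by (fact assms(2))
  have "n \<ge> 2"
    using assms(1) by simp
  then show ?thesis
    using type_II_form_exists not_symplectic[OF assms(1)] by metis
qed

end
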